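(* (Arimoto's Mr. Gerber's Lemma) Let $\delta\in[0,1]$, $0\le q\le\tfrac12$ and $\beta\ge 2$ (real). Let $X\in\{0,1\}$ with $\Pr(X=1)=q$, and let $Y$ be the output of the binary symmetric channel with crossover probability $\delta$ and input $X$. For $K_\beta(q)\le x\le 1$ let $U_{\mathbf T}(q,x)$ be the maximum of $K_\beta(Y|W)$ over all discrete random variables $W$ with $W\to X\to Y$ and $K_\beta(X|W)=x$, and let $\mathcal U^{(\beta)}=\{(x,U_{\mathbf T}(q,x)) : K_\beta(q)\le x\le 1\}$. Then $$\mathcal U^{(\beta)}=\left\{\left((1-\alpha)+\alpha K_\beta\!\left(\tfrac{q}{z}\right),\ \alpha K_\beta\!\left(\tfrac{q}{z}\star\delta\right)+(1-\alpha)K_\beta(\delta)\right) : \alpha\in[0,1],\ z=\max\{\alpha,2q\}\right\}$$ (when $\alpha=0$ the terms multiplied by $\alpha$ are read as $0$). In particular, for every $(x,y)\in\mathcal U^{(\beta)}$, $$\frac{\beta}{1-\beta}\log y=\max\left\{H_\beta(Y|W) : W\to X\to Y,\ H_\beta(X|W)\le\frac{\beta}{1-\beta}\log x\right\}.$$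
   Context: For $a,b\in[0,1]$, $a\star b=(1-a)b+(1-b)a$. The binary symmetric channel with crossover probability $\delta$ has $P_{Y|X}(1|0)=P_{Y|X}(0|1)=\delta$. $W\to X\to Y$ means that $W$ and $Y$ are conditionally independent given $X$; the joint law of $(X,Y)$ is fixed and $W$ varies over discrete random variables. For a finite-valued random variable $X$ and discrete $W$, the Arimoto conditional entropy of order $\beta$ is $H_\beta(X|W)=\frac{\beta}{1-\beta}\log\sum_w P_W(w)\,\|P_{X|W=w}\|_\beta$, where $\|\cdot\|_\beta$ is the $\ell^\beta$ norm of the probability vector; $H_\beta(X)=\frac{\beta}{1-\beta}\log\|P_X\|_\beta$ is the Rényi entropy. Set $K_\beta(X|W)=\exp\{\frac{1-\beta}{\beta}H_\beta(X|W)\}=\sum_w P_W(w)\|P_{X|W=w}\|_\beta$ and $K_\beta(X)=\exp\{\frac{1-\beta}{\beta}H_\beta(X)\}=\|P_X\|_\beta$; similarly for $Y$. For $p\in[0,1]$, $K_\beta(p)$ denotes $K_\beta$ of a Bernoulli$(p)$ variable, i.e. $K_\beta(p)=(p^\beta+(1-p)^\beta)^{1/\beta}$. Logarithms are natural.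
   Formalization: In the last formula, max and H_β(X|W) ≤ are replaced by min and H_β(X|W) ≥: since β/(1−β)<0, the printed form fails, e.g. for β=2, q=1/2, δ=1/10, α=1/3, with W uniform and X a flip of W with probability 0.103. *)

theory Defs
  imports "HOL-Probability.Probability"
begin

definition lp_norm :: "real \<Rightarrow> 'a::finite pmf \<Rightarrow> real" where
  "lp_norm \<beta> p = (\<Sum>a\<in>UNIV. pmf p a powr \<beta>) powr (1 / \<beta>)"

(* Random variables are functions on a discrete probability space M :: 'o pmf. *)

definition cond_dist :: "'o pmf \<Rightarrow> ('o \<Rightarrow> 'x) \<Rightarrow> ('o \<Rightarrow> 'w) \<Rightarrow> 'w \<Rightarrow> 'x pmf" where
  "cond_dist M X W w = map_pmf X (cond_pmf M (W -` {w}))"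

(* The expectation is the sum over w of P(W = w) * lp_norm \<beta> P(X | W = w);
   values w of probability 0, where cond_pmf is unspecified, do not contribute. *)
definition arimoto_K :: "real \<Rightarrow> 'o pmf \<Rightarrow> ('o \<Rightarrow> 'x::finite) \<Rightarrow> ('o \<Rightarrow> 'w) \<Rightarrow> real" where
  "arimoto_K \<beta> M X W =
     measure_pmf.expectation (map_pmf W M) (\<lambda>w. lp_norm \<beta> (cond_dist M X W w))"

definition arimoto_H :: "real \<Rightarrow> 'o pmf \<Rightarrow> ('o \<Rightarrow> 'x::finite) \<Rightarrow> ('o \<Rightarrow> 'w) \<Rightarrow> real" where
  "arimoto_H \<beta> M X W = \<beta> / (1 - \<beta>) * ln (arimoto_K \<beta> M X W)"

definition K_bern :: "real \<Rightarrow> real \<Rightarrow> real" where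
  "K_bern \<beta> p = lp_norm \<beta> (bernoulli_pmf p)"

definition markov_chain :: "'o pmf \<Rightarrow> ('o \<Rightarrow> 'w) \<Rightarrow> ('o \<Rightarrow> 'x) \<Rightarrow> ('o \<Rightarrow> 'y) \<Rightarrow> bool" where
  "markov_chain M W X Y \<longleftrightarrow>
     (\<forall>x\<in>set_pmf (map_pmf X M).
        cond_dist M (\<lambda>\<omega>. (W \<omega>, Y \<omega>)) X x = pair_pmf (cond_dist M W X x) (cond_dist M Y X x))"

definition bconv :: "real \<Rightarrow> real \<Rightarrow> real" where
  "bconv a b = (1 - a) * b + (1 - b) * a"

(* Input and output bits: True is 1, False is 0. *)
definition bsc :: "real \<Rightarrow> bool \<Rightarrow> bool pmf" where
  "bsc \<delta> x = map_pmf (\<lambda>flip. x \<noteq> flip) (bernoulli_pmf \<delta>)"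

definition bsc_joint :: "real \<Rightarrow> real \<Rightarrow> (bool \<times> bool) pmf" where
  "bsc_joint q \<delta> = do { x \<leftarrow> bernoulli_pmf q; y \<leftarrow> bsc \<delta> x; return_pmf (x, y) }"

abbreviation rv_W :: "nat \<times> bool \<times> bool \<Rightarrow> nat" where "rv_W \<equiv> fst"
abbreviation rv_X :: "nat \<times> bool \<times> bool \<Rightarrow> bool" where "rv_X \<equiv> \<lambda>\<omega>. fst (snd \<omega>)"
abbreviation rv_Y :: "nat \<times> bool \<times> bool \<Rightarrow> bool" where "rv_Y \<equiv> \<lambda>\<omega>. snd (snd \<omega>)"

(* The joint laws of (W, X, Y). A discrete W takes countably many values, and all quantities
   considered are unchanged when these are relabelled injectively, so W ranges over nat. *)
definition test_laws :: "real \<Rightarrow> real \<Rightarrow> (nat \<times> bool \<times> bool) pmf set" where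
  "test_laws \<delta> q = {M. map_pmf snd M = bsc_joint q \<delta> \<and> markov_chain M rv_W rv_X rv_Y}"

definition is_maximum :: "'a::order set \<Rightarrow> 'a \<Rightarrow> bool" where
  "is_maximum S m \<longleftrightarrow> m \<in> S \<and> (\<forall>s\<in>S. s \<le> m)"

(* For \<beta> > 1 the factor \<beta> / (1 - \<beta>) relating ln K to H is negative. Maximising K(Y|W) therefore
   means minimising H(Y|W), and K(X|W) \<le> x means H(X|W) \<ge> \<beta> / (1 - \<beta>) * ln x. With "maximum" and
   "\<le>" in terms of H, the entropy form fails for \<beta> = 2, q = 1/2, \<delta> = 1/10. *)
definition is_minimum :: "'a::order set \<Rightarrow> 'a \<Rightarrow> bool" where
  "is_minimum S m \<longleftrightarrow> m \<in> S \<and> (\<forall>s\<in>S. m \<le> s)"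

definition K_values :: "real \<Rightarrow> real \<Rightarrow> real \<Rightarrow> real \<Rightarrow> real set" where
  "K_values \<beta> \<delta> q x =
     {arimoto_K \<beta> M rv_Y rv_W |M. M \<in> test_laws \<delta> q \<and> arimoto_K \<beta> M rv_X rv_W = x}"

definition U_T :: "real \<Rightarrow> real \<Rightarrow> real \<Rightarrow> real \<Rightarrow> real" where
  "U_T \<beta> \<delta> q x = (THE m. is_maximum (K_values \<beta> \<delta> q x) m)"

definition U_curve :: "real \<Rightarrow> real \<Rightarrow> real \<Rightarrow> (real \<times> real) set" where
  "U_curve \<beta> \<delta> q = {(x, U_T \<beta> \<delta> q x) |x. K_bern \<beta> q \<le> x \<and> x \<le> 1}"

lemma arimoto_K_eq_exp_H:
  assumes "0 < arimoto_K \<beta> M X W" "\<beta> \<noteq> 0" "\<beta> \<noteq> 1"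
  shows "arimoto_K \<beta> M X W = exp ((1 - \<beta>) / \<beta> * arimoto_H \<beta> M X W)"
  using assms by (simp add: arimoto_H_def)

lemma K_bern_eq:
  assumes "0 \<le> p" "p \<le> 1"
  shows "K_bern \<beta> p = (p powr \<beta> + (1 - p) powr \<beta>) powr (1 / \<beta>)"
  using assms by (simp add: K_bern_def lp_norm_def UNIV_bool add.commute)

end

theory Submission
  imports Defs
begin

text \<open>
  Put g = K_bern \<beta>, h p = g (bconv p \<delta>) and let P be the random variable Pr(X = 1 | W). Then
  K(X|W) = E g(P), K(Y|W) = E h(P) and E P = q, so that the upper boundary is a question about
  supporting planes of the curve p \<mapsto> (p, g p, h p).

  By symmetry let \<delta> \<le> 1/2. One computes g''(p) = (\<beta> - 1) (p (1 - p))^(\<beta> - 2) (p^\<beta> + (1 - p)^\<beta>)^(1/\<beta> - 2).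
  For \<beta> \<ge> 2 the function (1 - 2 t) (ln g'')'(t) decreases on (0, 1/2], which makes h'' / g'' decrease there.
  For 0 < r \<le> 1/2 choose a, b, c such that D p = h p - a - b p - c g p has a zero at 0 and a double zero at r.
  Its second derivative g'' (h'' / g'' - c) changes sign at most once on (0, 1/2], from plus to minus,
  which forces D \<le> 0 on [0, 1/2] as well as b, c \<ge> 0; the symmetry of g and h then gives D \<le> 0 on [0, 1].
  Taking expectations, K(Y|W) \<le> a + b q + c K(X|W), with equality when P only takes the values 0 and r,
  and also when P takes the values 0, r, 1 if r = 1/2, where b = 0.
\<close>

section \<open>The norm of a Bernoulli law and its derivatives\<close>

definition K_deriv :: "real \<Rightarrow> real \<Rightarrow> real" where
  "K_deriv \<beta> p = (p powr (\<beta> - 1) - (1 - p) powr (\<beta> - 1))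
     * (p powr \<beta> + (1 - p) powr \<beta>) powr (1 / \<beta> - 1)"

text \<open>The logarithm of g'' up to the constant ln (\<beta> - 1). On this scale the quotient h''
  / g'' becomes a difference whose derivative is easy to control.\<close>

definition ln_K_deriv2 :: "real \<Rightarrow> real \<Rightarrow> real" where
  "ln_K_deriv2 \<beta> p = (\<beta> - 2) * (ln p + ln (1 - p))
     + (1 / \<beta> - 2) * ln (p powr \<beta> + (1 - p) powr \<beta>)"

lemma DERIV_K_bern:
  assumes "0 < p" "p < 1" "\<beta> \<noteq> 0"
  shows "(K_bern \<beta> has_real_derivative K_deriv \<beta> p) (at p)"
proof -
  have S: "0 < p powr \<beta> + (1 - p) powr \<beta>"
    using assms by (intro add_pos_pos) auto
  have "((\<lambda>p. (p powr \<beta> + (1 - p) powr \<beta>) powr (1 / \<beta>)) has_real_derivative K_deriv \<beta> p) (at p)"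
    using assms S unfolding K_deriv_def
    by (auto intro!: derivative_eq_intros simp: field_simps)
  \<comment> \<open>\<open>bernoulli_pmf\<close> clamps its parameter to [0, 1], so the closed form
    is available only there; a neighbourhood of p inside (0, 1) suffices for the derivative.\<close>
  moreover have "\<forall>\<^sub>F x in nhds p. K_bern \<beta> x = (x powr \<beta> + (1 - x) powr \<beta>) powr (1 / \<beta>)"
    using eventually_nhds_in_open[of "{0<..<1}" p] assms
    by (auto elim!: eventually_mono intro!: K_bern_eq)
  ultimately show ?thesis
    using DERIV_cong_ev[of p p "K_bern \<beta>"] by auto
qed

text \<open>With S = p^2 A + (1 - p)^2 B the product rule leaves the bracket (A + B) S - (p A - (1 -
  p) B)^2, which collapses to A B because p + (1 - p) = 1. Only a product of positive powers
  remains, so its logarithm is a sum.\<close>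

lemma DERIV_K_deriv:
  assumes "0 < p" "p < 1" "\<beta> \<noteq> 0"
  shows "(K_deriv \<beta> has_real_derivative (\<beta> - 1) * exp (ln_K_deriv2 \<beta> p)) (at p)"
proof -
  define A B where "A = p powr (\<beta> - 2)" and "B = (1 - p) powr (\<beta> - 2)"
  define S where "S = p powr \<beta> + (1 - p) powr \<beta>"
  have S: "0 < S"
    using assms unfolding S_def by (intro add_pos_pos) auto
  have pw: "x powr (\<beta> - 1) = x * x powr (\<beta> - 2)" "x powr \<beta> = x\<^sup>2 * x powr (\<beta> - 2)"
    if "0 < x" for x :: real
    using that powr_mult_base[of x "\<beta> - 2"] powr_mult_base[of x "\<beta> - 1"]
    by (auto simp: power2_eq_square mult.assoc)
  have SAB: "S = p\<^sup>2 * A + (1 - p)\<^sup>2 * B"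
    using assms by (simp add: S_def A_def B_def pw)
  have S1: "S powr (1 / \<beta> - 1) = S * S powr (1 / \<beta> - 2)"
    using S powr_mult_base[of S "1 / \<beta> - 2"] by simp
  have "(\<beta> - 1) * (A + B) * S powr (1 / \<beta> - 1)
      + (p * A - (1 - p) * B) * ((1 - \<beta>) * (S powr (1 / \<beta> - 2) * (p * A - (1 - p) * B)))
      = (\<beta> - 1) * S powr (1 / \<beta> - 2) * ((A + B) * S - (p * A - (1 - p) * B)\<^sup>2)"
    unfolding S1 by (simp add: power2_eq_square algebra_simps)
  also have "(A + B) * S - (p * A - (1 - p) * B)\<^sup>2 = A * B"
    unfolding SAB by (simp add: power2_eq_square algebra_simps)
  also have "(\<beta> - 1) * S powr (1 / \<beta> - 2) * (A * B) = (\<beta> - 1) * exp (ln_K_deriv2 \<beta> p)"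
    using assms S unfolding ln_K_deriv2_def S_def[symmetric]
    by (simp add: A_def B_def powr_def exp_add distrib_left mult_ac)
  finally have eq: "(\<beta> - 1) * (A + B) * S powr (1 / \<beta> - 1)
      + (p * A - (1 - p) * B) * ((1 - \<beta>) * (S powr (1 / \<beta> - 2) * (p * A - (1 - p) * B)))
      = (\<beta> - 1) * exp (ln_K_deriv2 \<beta> p)" .
  have e: "p powr (\<beta> - 1) = p * A" "(1 - p) powr (\<beta> - 1) = (1 - p) * B"
    using assms by (auto simp: A_def B_def pw)
  have d1: "((\<lambda>p. p powr (\<beta> - 1) - (1 - p) powr (\<beta> - 1)) has_real_derivative (\<beta> - 1) * (A + B)) (at p)"
    using assms by (auto intro!: derivative_eq_intros simp: A_def B_def algebra_simps)
  have dS: "((\<lambda>p. p powr \<beta> + (1 - p) powr \<beta>) has_real_derivative \<beta> * (p * A - (1 - p) * B)) (at p)"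
    unfolding e[symmetric] using assms by (auto intro!: derivative_eq_intros simp: algebra_simps)
  have d2: "((\<lambda>p. (p powr \<beta> + (1 - p) powr \<beta>) powr (1 / \<beta> - 1)) has_real_derivative
      (1 - \<beta>) * (S powr (1 / \<beta> - 2) * (p * A - (1 - p) * B))) (at p)"
    by (rule DERIV_cong[OF DERIV_chain2[OF has_real_derivative_powr[OF S[unfolded S_def]] dS]])
      (use assms in \<open>simp add: S_def left_diff_distrib right_diff_distrib\<close>)
  show ?thesis
    using DERIV_mult[OF d1 d2] unfolding K_deriv_def
    by (rule DERIV_cong) (simp add: eq[symmetric] e S_def mult_ac)
qed

section \<open>Monotonicity of the quotient of second derivatives\<close>

lemma ratio_mono:
  fixes v w \<beta> :: real
  assumes "0 < v" "v \<le> w" "w \<le> 1" "2 \<le> \<beta>"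
  shows "(v + v powr (\<beta> - 1)) / (1 + v powr \<beta>) \<le> (w + w powr (\<beta> - 1)) / (1 + w powr \<beta>)"
proof (rule DERIV_nonneg_imp_nondecreasing[OF assms(2)])
  fix x assume x: "v \<le> x" "x \<le> w"
  define A where "A = x powr (\<beta> - 2)"
  have x0: "0 < x" "x \<le> 1" using x assms by auto
  have pw: "x powr (\<beta> - 1) = x * A" "x powr \<beta> = x\<^sup>2 * A"
    using x0 powr_mult_base[of x "\<beta> - 2"] powr_mult_base[of x "\<beta> - 1"]
    by (auto simp: power2_eq_square mult.assoc A_def)
  have A: "0 < A" "A \<le> 1" using x0 assms by (auto simp: A_def powr_le1)
  \<comment> \<open>The numerator that the quotient rule produces. After regrouping, both summands
    are nonnegative by x \<le> 1 and A \<le> 1, the latter being where \<beta> \<ge> 2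
    enters.\<close>
  let ?N = "(1 + (\<beta> - 1) * A) * (1 + x\<^sup>2 * A) - (x + x * A) * (\<beta> * (x * A))"
  have "?N = (1 - (x * A)\<^sup>2) + (\<beta> - 1) * (A * (1 - x\<^sup>2))"
    by (simp add: power2_eq_square algebra_simps)
  moreover have "(x * A)\<^sup>2 \<le> 1" using A x0 by (intro power_le_one) (auto intro: mult_le_one)
  moreover have "x\<^sup>2 \<le> 1" using x0 by (intro power_le_one) auto
  ultimately have N: "0 \<le> ?N" using A assms by simp
  have p: "0 < 1 + x powr \<beta>" using x0 by (simp add: add_pos_pos)
  have "((\<lambda>x. (x + x powr (\<beta> - 1)) / (1 + x powr \<beta>)) has_real_derivative
     ?N / ((1 + x powr \<beta>) * (1 + x powr \<beta>))) (at x)"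
    using x0 p
    by (auto intro!: derivative_eq_intros simp: pw(1) A_def[symmetric])
      (simp_all add: pw mult_ac)
  then show "\<exists>y. ((\<lambda>x. (x + x powr (\<beta> - 1)) / (1 + x powr \<beta>)) has_real_derivative y) (at x) \<and> 0 \<le> y"
    using N p by (intro exI[of _ "?N / ((1 + x powr \<beta>) * (1 + x powr \<beta>))"]) simp
qed

definition ln_K_deriv3 :: "real \<Rightarrow> real \<Rightarrow> real" where
  "ln_K_deriv3 \<beta> p = (\<beta> - 2) * (1 / p - 1 / (1 - p))
     + (1 - 2 * \<beta>) * ((p powr (\<beta> - 1) - (1 - p) powr (\<beta> - 1)) / (p powr \<beta> + (1 - p) powr \<beta>))"

lemma DERIV_ln_K_deriv2:
  assumes "0 < p" "p < 1" "\<beta> \<noteq> 0"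
  shows "(ln_K_deriv2 \<beta> has_real_derivative ln_K_deriv3 \<beta> p) (at p)"
proof -
  have S: "0 < p powr \<beta> + (1 - p) powr \<beta>"
    using assms by (intro add_pos_pos) auto
  have "(1 / \<beta> - 2) * ((\<beta> * p powr (\<beta> - 1) - \<beta> * (1 - p) powr (\<beta> - 1)) / (p powr \<beta> + (1 - p) powr \<beta>))
     = (1 - 2 * \<beta>) * ((p powr (\<beta> - 1) - (1 - p) powr (\<beta> - 1)) / (p powr \<beta> + (1 - p) powr \<beta>))"
    using assms by (simp add: diff_divide_distrib right_diff_distrib left_diff_distrib)
  then show ?thesis
    using assms S unfolding ln_K_deriv2_def ln_K_deriv3_def
    by (auto intro!: derivative_eq_intros simp: mult.commute)
qed

text \<open>
  In terms of w = t / (1 - t), the powr part of (1 - 2 t) (ln g'')'(t) is, up to a positive factor,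
  1 - (w + w powr (\<beta> - 1)) / (1 + w powr \<beta>).
\<close>

lemma ln_K_deriv3_antimono:
  assumes "0 < s" "s \<le> t" "t \<le> 1 / 2" "2 \<le> \<beta>"
  shows "(1 - 2 * t) * ln_K_deriv3 \<beta> t \<le> (1 - 2 * s) * ln_K_deriv3 \<beta> s"
proof -
  let ?R = "\<lambda>w. (w + w powr (\<beta> - 1)) / (1 + w powr \<beta>)"
  \<comment> \<open>Both summands are antitone in p and carry the nonnegative weights \<beta> - 2
    and 2 \<beta> - 1, so they can be treated separately: a rational one, and one through
    \<open>ratio_mono\<close> at the odds p / (1 - p).\<close>
  have eq: "(1 - 2 * p) * ln_K_deriv3 \<beta> p = (\<beta> - 2) * (1 / (p * (1 - p)) - 4)
      + (2 * \<beta> - 1) * (1 - ?R (p / (1 - p)))" if p: "0 < p" "p \<le> 1 / 2" for p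
  proof -
    define A B where "A = p powr (\<beta> - 1)" and "B = (1 - p) powr (\<beta> - 1)"
    have AB: "0 < A" "0 < B" using p by (auto simp: A_def B_def)
    have S: "p powr \<beta> = p * A" "(1 - p) powr \<beta> = (1 - p) * B"
      using p powr_mult_base[of p "\<beta> - 1"] powr_mult_base[of "1 - p" "\<beta> - 1"]
      by (auto simp: A_def B_def)
    have pos: "0 < p * A + (1 - p) * B" using p AB by (intro add_pos_pos) auto
    have w: "(p / (1 - p)) powr (\<beta> - 1) = A / B" "(p / (1 - p)) powr \<beta> = (p * A) / ((1 - p) * B)"
      using p by (auto simp: powr_divide S) (auto simp: A_def B_def)
    have "?R (p / (1 - p)) = (p * B + (1 - p) * A) / (p * A + (1 - p) * B)"
      unfolding w using p AB pos by (simp add: divide_simps) (simp add: algebra_simps)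
    moreover have "1 - (p * B + (1 - p) * A) / (p * A + (1 - p) * B)
        = (2 * p - 1) * ((A - B) / (p * A + (1 - p) * B))"
      using pos by (simp add: divide_simps) (simp add: algebra_simps)
    ultimately have "1 - ?R (p / (1 - p)) = (2 * p - 1) * ((A - B) / (p * A + (1 - p) * B))"
      by simp
    moreover have "(1 - 2 * p) * (1 / p - 1 / (1 - p)) = 1 / (p * (1 - p)) - 4"
      using p by (simp add: divide_simps) (simp add: algebra_simps)
    moreover have "(1 - 2 * p) * ln_K_deriv3 \<beta> p = (\<beta> - 2) * ((1 - 2 * p) * (1 / p - 1 / (1 - p)))
       + (2 * \<beta> - 1) * ((2 * p - 1) * ((A - B) / (p * A + (1 - p) * B)))"
      unfolding ln_K_deriv3_def S A_def[symmetric] B_def[symmetric]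
      by (simp only: mult.assoc[symmetric] times_divide_eq_right) (simp add: algebra_simps add_divide_distrib diff_divide_distrib)
    ultimately show ?thesis by simp
  qed
  \<comment> \<open>This product equals t (1 - t) - s (1 - s).\<close>
  have "0 \<le> (t - s) * (1 - t - s)" using assms by simp
  then have "s * (1 - s) \<le> t * (1 - t)" by (simp add: algebra_simps)
  moreover have "0 < s * (1 - s)" using assms by simp
  ultimately have 1: "1 / (t * (1 - t)) \<le> 1 / (s * (1 - s))"
    by (simp add: frac_le)
  have "s / (1 - s) \<le> t / (1 - t)" using assms by (intro frac_le) auto
  then have 2: "?R (s / (1 - s)) \<le> ?R (t / (1 - t))"
    using assms by (intro ratio_mono) auto
  show ?thesis
    using assms 1 2 by (subst (1 2) eq) (auto intro!: add_mono mult_left_mono)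
qed

text \<open>This says that h'' / g'' decreases on (0, 1/2], in logarithmic form and up to the
  constant (1 - 2 \<delta>)^2. Since 1 - 2 \<open>bconv x \<delta>\<close> = (1 - 2 x) (1 - 2
  \<delta>) and \<open>bconv\<close> moves x towards 1/2, \<open>ln_K_deriv3_antimono\<close> gives
  the sign of the derivative.\<close>

lemma deriv2_ratio_antimono:
  assumes "0 < s" "s \<le> t" "t \<le> 1 / 2" "2 \<le> \<beta>" "0 \<le> \<delta>" "\<delta> \<le> 1 / 2"
  shows "ln_K_deriv2 \<beta> (bconv t \<delta>) - ln_K_deriv2 \<beta> t \<le> ln_K_deriv2 \<beta> (bconv s \<delta>) - ln_K_deriv2 \<beta> s"
proof (cases "s = t")
  case False
  then have st: "s < t" using assms by simp
  let ?f = "\<lambda>x. ln_K_deriv2 \<beta> (bconv x \<delta>) - ln_K_deriv2 \<beta> x"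
  have bc: "x \<le> bconv x \<delta>" "bconv x \<delta> \<le> 1 / 2" if "0 < x" "x \<le> 1 / 2" for x
  proof -
    have "bconv x \<delta> = x + \<delta> * (1 - 2 * x)" "bconv x \<delta> = 1 / 2 - (1 - 2 * \<delta>) * (1 - 2 * x) / 2"
      by (simp_all add: bconv_def field_simps)
    moreover have "0 \<le> \<delta> * (1 - 2 * x)" "0 \<le> (1 - 2 * \<delta>) * (1 - 2 * x)" using that assms by simp_all
    ultimately show "x \<le> bconv x \<delta>" "bconv x \<delta> \<le> 1 / 2" by simp_all
  qed
  have d: "(?f has_real_derivative (1 - 2 * \<delta>) * ln_K_deriv3 \<beta> (bconv x \<delta>) - ln_K_deriv3 \<beta> x) (at x)"
    if "0 < x" "x \<le> 1 / 2" for x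
  proof -
    have 1: "((\<lambda>x. bconv x \<delta>) has_real_derivative 1 - 2 * \<delta>) (at x)"
      unfolding bconv_def by (auto intro!: derivative_eq_intros)
    have "(ln_K_deriv2 \<beta> has_real_derivative ln_K_deriv3 \<beta> (bconv x \<delta>)) (at (bconv x \<delta>))"
      using bc[OF that] that assms by (intro DERIV_ln_K_deriv2) auto
    from DERIV_diff[OF DERIV_chain2[OF this 1] DERIV_ln_K_deriv2[of x \<beta>]] show ?thesis
      using that assms by (simp add: mult.commute)
  qed
  have "?f t \<le> ?f s"
  proof (rule DERIV_nonpos_imp_decreasing_open[where f = ?f and a = s and b = t])
    show "s \<le> t" using st by simp
    show "continuous_on {s..t} ?f"
      using assms by (intro DERIV_atLeastAtMost_imp_continuous_on) (auto intro!: exI d)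
    \<comment> \<open>Interior points suffice, so x < 1/2 and the common factor 1 - 2 x can be
      cancelled.\<close>
    fix x assume x: "s < x" "x < t"
    then have x': "0 < x" "x < 1 / 2" using assms by auto
    have "(1 - 2 * bconv x \<delta>) * ln_K_deriv3 \<beta> (bconv x \<delta>) \<le> (1 - 2 * x) * ln_K_deriv3 \<beta> x"
      using x' bc[of x] assms by (intro ln_K_deriv3_antimono) auto
    also have "1 - 2 * bconv x \<delta> = (1 - 2 * x) * (1 - 2 * \<delta>)"
      by (simp add: bconv_def algebra_simps)
    finally have "(1 - 2 * \<delta>) * ln_K_deriv3 \<beta> (bconv x \<delta>) \<le> ln_K_deriv3 \<beta> x"
      using x' by (simp add: mult.assoc)
    then show "\<exists>y. (?f has_real_derivative y) (at x) \<and> y \<le> 0"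
      using d[of x] x' by (intro exI conjI) auto
  qed
  then show ?thesis .
qed simp

section \<open>Supporting planes\<close>

text \<open>The assumption \<open>sign\<close> makes D first convex, then concave. A level chord
  from 0 to r together with a horizontal tangent at r places r in the concave part and makes it a
  maximum point.\<close>

lemma tangent_chord_bound:
  fixes D D1 D2 :: "real \<Rightarrow> real"
  assumes cont: "continuous_on {0..m} D"
    and D1: "\<And>p. \<lbrakk>0 < p; p \<le> m\<rbrakk> \<Longrightarrow> (D has_real_derivative D1 p) (at p)"
    and D2: "\<And>p. \<lbrakk>0 < p; p \<le> m\<rbrakk> \<Longrightarrow> (D1 has_real_derivative D2 p) (at p)"
    and sign: "\<And>s t. \<lbrakk>0 < s; s \<le> t; t \<le> m; 0 < D2 t\<rbrakk> \<Longrightarrow> 0 < D2 s"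
    and r: "0 < r" "r \<le> m" and eq: "D 0 = D r" "D1 r = 0"
  shows "D2 r \<le> 0" and "D1 m \<le> 0" and "\<lbrakk>0 \<le> p; p \<le> m\<rbrakk> \<Longrightarrow> D p \<le> D r"
proof -
  \<comment> \<open>The left end 0 is included, where D is only assumed continuous.\<close>
  have mvt: "\<exists>z. x < z \<and> z < y \<and> D y - D x = (y - x) * D1 z" if "0 \<le> x" "x < y" "y \<le> m" for x y
  proof -
    have "\<exists>l z. x < z \<and> z < y \<and> (D has_real_derivative l) (at z) \<and> D y - D x = (y - x) * l"
      using that by (intro MVT continuous_on_subset[OF cont])
        (auto simp: real_differentiable_def intro!: exI D1)
    then obtain l z where z: "x < z" "z < y" "(D has_real_derivative l) (at z)" "D y - D x = (y - x) * l"
      by blast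
    then have "l = D1 z" using D1[of z] that by (intro DERIV_unique) auto
    then show ?thesis using z by blast
  qed
  have mvt2: "\<exists>z. x < z \<and> z < y \<and> D1 y - D1 x = (y - x) * D2 z" if "0 < x" "x < y" "y \<le> m" for x y
    using that D2 by (intro MVT2) auto
  have D1_less: "D1 x < D1 y" if xy: "0 < x" "x < y" "y \<le> t" "t \<le> m" "0 < D2 t" for x y t
  proof -
    obtain z where "x < z" "z < y" "D1 y - D1 x = (y - x) * D2 z"
      using mvt2[of x y] xy by auto
    moreover from this have "0 < D2 z" using sign[of z t] xy by auto
    ultimately show ?thesis using xy by (metis diff_gt_0_iff_gt mult_pos_pos)
  qed
  \<comment> \<open>If D2 were positive at some t \<ge> r, D1 would increase strictly up to t; Rolle
    on [0, r] gives a zero of D1 before r, contradicting the zero at r.\<close>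
  have nonpos: "D2 t \<le> 0" if "r \<le> t" "t \<le> m" for t
  proof (rule ccontr)
    assume "\<not> D2 t \<le> 0"
    obtain z where z: "0 < z" "z < r" "D r - D 0 = (r - 0) * D1 z"
      using mvt[of 0 r] r by auto
    then have "D1 z = 0" using eq r by simp
    moreover have "D1 z < D1 r" using D1_less[of z r t] z r that \<open>\<not> D2 t \<le> 0\<close> by auto
    ultimately show False using eq by simp
  qed
  show "D2 r \<le> 0" using nonpos r by simp
  have D1_nonpos: "D1 t \<le> 0" if t: "r \<le> t" "t \<le> m" for t
  proof (cases "r = t")
    case False
    obtain z where "r < z" "z < t" "D1 t - D1 r = (t - r) * D2 z"
      using mvt2[of r t] t r False by auto
    then show ?thesis using eq nonpos[of z] t by (simp add: mult_nonneg_nonpos)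
  qed (use eq in simp)
  show "D1 m \<le> 0" using D1_nonpos r by simp
  show "D p \<le> D r" if p: "0 \<le> p" "p \<le> m"
  proof (rule ccontr)
    assume less: "\<not> D p \<le> D r"
    show False
    proof (cases "p < r")
      case True
      \<comment> \<open>A value above D 0 = D r makes D1 positive at some x < p and negative at some
        y in (p, r). The return of D1 to 0 at r needs D2 positive beyond y, hence everywhere before,
        so D1 could not have dropped from x to y.\<close>
      have "p \<noteq> 0" using less eq by auto
      then obtain x where x: "0 < x" "x < p" "D p - D 0 = (p - 0) * D1 x"
        using mvt[of 0 p] p by auto
      obtain y where y: "p < y" "y < r" "D r - D p = (r - p) * D1 y"
        using mvt[of p r] p True r by auto
      have "0 < p * D1 x" using x less eq by simp
      then have "0 < D1 x" using x by (simp add: zero_less_mult_iff)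
      have "(r - p) * D1 y < 0" using y less by simp
      then have "D1 y < 0" using y by (simp add: mult_less_0_iff)
      obtain z where z: "y < z" "z < r" "D1 r - D1 y = (r - y) * D2 z"
        using mvt2[of y r] y p r by auto
      have "0 < (r - y) * D2 z" using z eq \<open>D1 y < 0\<close> by simp
      then have "0 < D2 z" using z y by (simp add: zero_less_mult_iff)
      then have "D1 x < D1 y" using D1_less[of x y z] x y z r by auto
      then show False using \<open>0 < D1 x\<close> \<open>D1 y < 0\<close> by simp
    next
      case False
      have "p \<noteq> r" using less by auto
      then obtain z where "r < z" "z < p" "D p - D r = (p - r) * D1 z"
        using mvt[of r p] False p r by auto
      then have "D p - D r \<le> 0" using D1_nonpos[of z] p by (simp add: mult_nonneg_nonpos)
      then show False using less by simp
    qed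
  qed
qed

section \<open>Continuity, symmetry and convexity of the norm\<close>

lemma continuous_on_K_bern: "0 < \<beta> \<Longrightarrow> continuous_on {0..1} (K_bern \<beta>)"
proof -
  assume "0 < \<beta>"
  then have "continuous_on {0..1} (\<lambda>p. (p powr \<beta> + (1 - p) powr \<beta>) powr (1 / \<beta>))"
    by (intro continuous_on_powr' continuous_intros) (auto simp: add_nonneg_nonneg)
  then show ?thesis
    by (rule continuous_on_eq) (simp add: K_bern_eq)
qed

lemma K_bern_0: "0 < \<beta> \<Longrightarrow> K_bern \<beta> 0 = 1" and K_bern_1: "0 < \<beta> \<Longrightarrow> K_bern \<beta> 1 = 1"
  by (simp_all add: K_bern_eq)

lemma K_bern_symmetric: "0 \<le> p \<Longrightarrow> p \<le> 1 \<Longrightarrow> K_bern \<beta> (1 - p) = K_bern \<beta> p"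
  by (simp add: K_bern_eq add.commute)

lemma bconv_bounds:
  assumes "0 \<le> p" "p \<le> 1" "0 \<le> \<delta>" "\<delta> \<le> 1"
  shows "0 \<le> bconv p \<delta>" "bconv p \<delta> \<le> 1"
proof -
  show "0 \<le> bconv p \<delta>" using assms by (simp add: bconv_def)
  have "1 - bconv p \<delta> = (1 - p) * (1 - \<delta>) + p * \<delta>" by (simp add: bconv_def algebra_simps)
  moreover have "0 \<le> (1 - p) * (1 - \<delta>) + p * \<delta>" using assms by simp
  ultimately show "bconv p \<delta> \<le> 1" by simp
qed

text \<open>Complementing the input or the channel complements the output bit. This reduces
  everything to p \<le> 1/2 and \<delta> \<le> 1/2.\<close>

lemma K_bern_bconv_complement:
  assumes "0 \<le> p" "p \<le> 1" "0 \<le> \<delta>" "\<delta> \<le> 1"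
  shows "K_bern \<beta> (bconv (1 - p) \<delta>) = K_bern \<beta> (bconv p \<delta>)"
    and "K_bern \<beta> (bconv p (1 - \<delta>)) = K_bern \<beta> (bconv p \<delta>)"
proof -
  have "bconv (1 - p) \<delta> = 1 - bconv p \<delta>" "bconv p (1 - \<delta>) = 1 - bconv p \<delta>"
    by (simp_all add: bconv_def algebra_simps)
  then show "K_bern \<beta> (bconv (1 - p) \<delta>) = K_bern \<beta> (bconv p \<delta>)"
    and "K_bern \<beta> (bconv p (1 - \<delta>)) = K_bern \<beta> (bconv p \<delta>)"
    using bconv_bounds[OF assms] by (simp_all add: K_bern_symmetric)
qed

lemma K_deriv_half: "K_deriv \<beta> (1 / 2) = 0"
  by (simp add: K_deriv_def)

lemma K_deriv_strict_mono:
  assumes "0 < s" "s < t" "t < 1" "1 < \<beta>"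
  shows "K_deriv \<beta> s < K_deriv \<beta> t"
  by (rule DERIV_pos_imp_increasing[OF assms(2)])
    (use assms in \<open>auto intro!: exI[of _ "(\<beta> - 1) * exp (ln_K_deriv2 \<beta> _)"] DERIV_K_deriv\<close>)

lemma K_bern_MVT:
  assumes "0 \<le> s" "s < t" "t \<le> 1" "0 < \<beta>"
  obtains z where "s < z" "z < t" "K_bern \<beta> t - K_bern \<beta> s = (t - s) * K_deriv \<beta> z"
proof -
  have "\<exists>l z. s < z \<and> z < t \<and> (K_bern \<beta> has_real_derivative l) (at z)
      \<and> K_bern \<beta> t - K_bern \<beta> s = (t - s) * l"
    using assms
    by (intro MVT continuous_on_subset[OF continuous_on_K_bern[of \<beta>]])
      (auto simp: real_differentiable_def intro!: exI DERIV_K_bern)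
  then obtain l z where z: "s < z" "z < t" "(K_bern \<beta> has_real_derivative l) (at z)"
      "K_bern \<beta> t - K_bern \<beta> s = (t - s) * l" by blast
  moreover have "l = K_deriv \<beta> z" using z assms by (intro DERIV_unique[OF z(3)] DERIV_K_bern) auto
  ultimately show thesis using that by blast
qed

text \<open>Convexity of g along chords that start at (0, 1): the derivative increases, so the mean
  slope on [0, l r] is at most that on [l r, r].\<close>

lemma K_bern_chord:
  assumes "0 \<le> l" "l \<le> 1" "0 \<le> r" "r \<le> 1" "1 < \<beta>"
  shows "K_bern \<beta> (l * r) \<le> (1 - l) + l * K_bern \<beta> r"
proof (cases "l * r = 0 \<or> l = 1")
  case True
  then show ?thesis using assms by (auto simp: K_bern_0)
next
  case False
  then have lr: "0 < l * r" "l * r < r" using assms by (auto simp: less_le)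
  obtain x where x: "0 < x" "x < l * r" "K_bern \<beta> (l * r) - K_bern \<beta> 0 = (l * r - 0) * K_deriv \<beta> x"
    using K_bern_MVT[of 0 "l * r" \<beta>] lr assms by auto
  obtain y where y: "l * r < y" "y < r" "K_bern \<beta> r - K_bern \<beta> (l * r) = (r - l * r) * K_deriv \<beta> y"
    using K_bern_MVT[of "l * r" r \<beta>] lr assms by auto
  have "K_deriv \<beta> x \<le> K_deriv \<beta> y" using K_deriv_strict_mono[of x y \<beta>] x y assms by auto
  \<comment> \<open>The two intervals have lengths l r and (1 - l) r; this weight is common to both
    increments once they are scaled by 1 - l and l.\<close>
  then have "(l * (1 - l) * r) * K_deriv \<beta> x \<le> (l * (1 - l) * r) * K_deriv \<beta> y"
    using assms by (intro mult_left_mono) auto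
  moreover have "(1 - l) * (K_bern \<beta> (l * r) - 1) = (l * (1 - l) * r) * K_deriv \<beta> x"
    using x assms by (simp add: K_bern_0)
  moreover have "l * (K_bern \<beta> r - K_bern \<beta> (l * r)) = (l * (1 - l) * r) * K_deriv \<beta> y"
    unfolding y(3) by (simp add: algebra_simps)
  ultimately have "(1 - l) * (K_bern \<beta> (l * r) - 1) \<le> l * (K_bern \<beta> r - K_bern \<beta> (l * r))" by linarith
  then show ?thesis by (simp add: algebra_simps)
qed

lemma K_bern_bounds:
  assumes "0 \<le> p" "p \<le> 1" "1 < \<beta>"
  shows "1 / 2 \<le> K_bern \<beta> p" "K_bern \<beta> p \<le> 1"
proof -
  show "K_bern \<beta> p \<le> 1"
    using K_bern_chord[of p 1 \<beta>] assms by (simp add: K_bern_1)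
  \<comment> \<open>The norm dominates the larger of the two probabilities, which is at least
    1/2.\<close>
  have "(1 / 2) powr \<beta> \<le> max p (1 - p) powr \<beta>" using assms by (intro powr_mono2) (auto simp: max_def)
  also have "\<dots> \<le> p powr \<beta> + (1 - p) powr \<beta>" by (simp add: max_def)
  finally have "((1 / 2) powr \<beta>) powr (1 / \<beta>) \<le> (p powr \<beta> + (1 - p) powr \<beta>) powr (1 / \<beta>)"
    using assms by (intro powr_mono2) auto
  then show "1 / 2 \<le> K_bern \<beta> p"
    using assms by (simp only: K_bern_eq powr_powr) simp
qed

section \<open>Construction of the supporting planes\<close>

text \<open>The plane meets the curve over 0 and touches it over r;
  \<open>tangent_chord_bound\<close> on [0, 1/2] gives the inequality, with a = D r. The sign of c
  later permits inserting an upper bound on K(X|W), the sign of b permits reflection at 1/2.\<close>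

lemma supporting_line_half:
  assumes "0 \<le> \<delta>" "\<delta> \<le> 1 / 2" "2 \<le> \<beta>" "0 < r" "r \<le> 1 / 2"
  obtains c b a where "0 \<le> c" "0 \<le> b" "r = 1 / 2 \<longrightarrow> b = 0"
    and "\<forall>p\<in>{0..1 / 2}. K_bern \<beta> (bconv p \<delta>) \<le> a + b * p + c * K_bern \<beta> p"
    and "K_bern \<beta> (bconv 0 \<delta>) = a + c * K_bern \<beta> 0"
    and "K_bern \<beta> (bconv r \<delta>) = a + b * r + c * K_bern \<beta> r"
proof -
  define k where "k = 1 - 2 * \<delta>"
  let ?g = "K_bern \<beta>" and ?g1 = "K_deriv \<beta>" and ?g2 = "\<lambda>p. (\<beta> - 1) * exp (ln_K_deriv2 \<beta> p)"
  let ?h = "\<lambda>p. K_bern \<beta> (bconv p \<delta>)" and ?h1 = "\<lambda>p. k * K_deriv \<beta> (bconv p \<delta>)"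
    and ?h2 = "\<lambda>p. k\<^sup>2 * ?g2 (bconv p \<delta>)"
  have bc: "0 < bconv p \<delta>" "bconv p \<delta> < 1" if "0 < p" "p \<le> 1 / 2" for p
  proof -
    have "bconv p \<delta> = p + \<delta> * (1 - 2 * p)" "bconv p \<delta> = 1 / 2 - k * (1 - 2 * p) / 2"
      by (simp_all add: bconv_def k_def field_simps)
    moreover have "0 \<le> \<delta> * (1 - 2 * p)" "0 \<le> k * (1 - 2 * p)" using that assms by (simp_all add: k_def)
    ultimately show "0 < bconv p \<delta>" "bconv p \<delta> < 1" using that by simp_all
  qed
  have dbc: "((\<lambda>x. bconv x \<delta>) has_real_derivative k) (at x)" for x
    unfolding bconv_def k_def by (auto intro!: derivative_eq_intros)
  have h1: "(?h has_real_derivative ?h1 p) (at p)" if "0 < p" "p \<le> 1 / 2" for p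
    using DERIV_chain2[OF DERIV_K_bern[OF bc[OF that]] dbc] assms by (simp add: mult.commute)
  have h2: "(?h1 has_real_derivative ?h2 p) (at p)" if "0 < p" "p \<le> 1 / 2" for p
    using DERIV_cmult[OF DERIV_chain2[OF DERIV_K_deriv[OF bc[OF that]] dbc], of \<beta> k] assms
    by (simp add: power2_eq_square mult_ac)
  have g1: "(?g has_real_derivative ?g1 p) (at p)" if "0 < p" "p \<le> 1 / 2" for p
    using that assms by (intro DERIV_K_bern) auto
  have g2: "(?g1 has_real_derivative ?g2 p) (at p)" if "0 < p" "p \<le> 1 / 2" for p
    using that assms by (intro DERIV_K_deriv) auto
  have conth: "continuous_on {0..1 / 2} ?h"
  proof (rule continuous_on_compose2[OF continuous_on_K_bern])
    show "continuous_on {0..1 / 2} (\<lambda>p. bconv p \<delta>)"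
      unfolding bconv_def by (intro continuous_intros)
  qed (use assms bconv_bounds[of _ \<delta>] in auto)
  have contg: "continuous_on {0..1 / 2} ?g"
    by (rule continuous_on_subset[OF continuous_on_K_bern]) (use assms in auto)
  \<comment> \<open>Antitonicity of h'' / g'' in cross-multiplied form.\<close>
  have ratio: "?h2 t * ?g2 s \<le> ?h2 s * ?g2 t" if "0 < s" "s \<le> t" "t \<le> 1 / 2" for s t
  proof -
    have "ln_K_deriv2 \<beta> (bconv t \<delta>) + ln_K_deriv2 \<beta> s \<le> ln_K_deriv2 \<beta> (bconv s \<delta>) + ln_K_deriv2 \<beta> t"
      using deriv2_ratio_antimono[OF that assms(3,1,2)] by simp
    then have "exp (ln_K_deriv2 \<beta> (bconv t \<delta>)) * exp (ln_K_deriv2 \<beta> s)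
        \<le> exp (ln_K_deriv2 \<beta> (bconv s \<delta>)) * exp (ln_K_deriv2 \<beta> t)"
      by (simp add: exp_add[symmetric])
    then have "(k\<^sup>2 * (\<beta> - 1)\<^sup>2) * (exp (ln_K_deriv2 \<beta> (bconv t \<delta>)) * exp (ln_K_deriv2 \<beta> s))
        \<le> (k\<^sup>2 * (\<beta> - 1)\<^sup>2) * (exp (ln_K_deriv2 \<beta> (bconv s \<delta>)) * exp (ln_K_deriv2 \<beta> t))"
      by (intro mult_left_mono) auto
    then show ?thesis by (simp add: power2_eq_square mult_ac)
  qed
  \<comment> \<open>By strict convexity the tangent of g at r runs strictly below g at 0, so the
    denominator of c is positive.\<close>
  obtain z where z: "0 < z" "z < r" "?g r - ?g 0 = (r - 0) * ?g1 z"
    using K_bern_MVT[of 0 r \<beta>] assms by auto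
  have "r * ?g1 z < r * ?g1 r"
    using K_deriv_strict_mono[of z r \<beta>] z assms by (intro mult_strict_left_mono) auto
  then have den: "0 < ?g 0 - ?g r + r * ?g1 r" using z(3) by simp
  \<comment> \<open>b and c are determined by D 0 = D r and D1 r = 0 below\<close>
  define c where "c = (?h 0 - ?h r + r * ?h1 r) / (?g 0 - ?g r + r * ?g1 r)"
  define b where "b = ?h1 r - c * ?g1 r"
  define D D1 D2 where "D p = ?h p - c * ?g p - b * p"
    and "D1 p = ?h1 p - c * ?g1 p - b" and "D2 p = ?h2 p - c * ?g2 p" for p
  have ceq: "c * (?g 0 - ?g r + r * ?g1 r) = ?h 0 - ?h r + r * ?h1 r"
    using den by (simp add: c_def)
  have D0: "D 0 = D r"
    using ceq by (simp add: D_def b_def algebra_simps)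
  have cont: "continuous_on {0..1 / 2} D"
    unfolding D_def by (intro continuous_intros conth contg)
  have dD: "(D has_real_derivative D1 p) (at p)" if "0 < p" "p \<le> 1 / 2" for p
    unfolding D_def D1_def
    by (rule derivative_eq_intros h1 g1 that refl | simp)+
  have dD1: "(D1 has_real_derivative D2 p) (at p)" if "0 < p" "p \<le> 1 / 2" for p
    unfolding D1_def D2_def
    by (rule derivative_eq_intros h2 g2 that refl | simp)+
  \<comment> \<open>D2 is positive exactly where h'' / g'' exceeds c, and this quotient is at least
    as large further left.\<close>
  have sign: "0 < D2 s" if "0 < s" "s \<le> t" "t \<le> 1 / 2" "0 < D2 t" for s t
  proof -
    have g2pos: "0 < ?g2 p" for p using assms by simp
    have "c * ?g2 t * ?g2 s < ?h2 t * ?g2 s"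
      using that(4) g2pos[of s] by (intro mult_strict_right_mono) (auto simp: D2_def)
    also have "\<dots> \<le> ?h2 s * ?g2 t" using ratio[OF that(1-3)] .
    finally have "(c * ?g2 s) * ?g2 t < ?h2 s * ?g2 t" by (simp add: mult_ac)
    then have "c * ?g2 s < ?h2 s" using g2pos[of t] by (simp only: mult_less_cancel_right)
    then show ?thesis by (simp add: D2_def)
  qed
  have D1r: "D1 r = 0" by (simp add: D1_def b_def)
  note tangent = tangent_chord_bound[of "1 / 2" D D1 D2 r, OF cont _ _ _ assms(4,5) D0 D1r]
  have bounds: "D2 r \<le> 0" "D1 (1 / 2) \<le> 0"
    by ((rule tangent; fact dD dD1 sign)+)
  have D_le: "D p \<le> D r" if "0 \<le> p" "p \<le> 1 / 2" for p
    by (rule tangent(3); fact dD dD1 sign that)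
  have bh: "bconv (1 / 2) \<delta> = 1 / 2" by (simp add: bconv_def field_simps)
  show thesis
  proof (rule that[of c b "D r"])
    \<comment> \<open>At r the product c g'' dominates h'' \<ge> 0, while g'' > 0.\<close>
    have "?h2 r \<le> c * ?g2 r" using bounds(1) by (simp add: D2_def)
    moreover have "0 \<le> ?h2 r" using assms by simp
    ultimately have "0 \<le> c * ?g2 r" by linarith
    moreover have "0 < ?g2 r" using assms by simp
    ultimately show "0 \<le> c" by (simp only: zero_le_mult_iff) auto
    \<comment> \<open>\<open>bconv\<close> fixes 1/2 and g' vanishes there, so D1 (1/2) = -b. For r
      = 1/2 the tangency makes this 0.\<close>
    show "0 \<le> b" using bounds(2) by (simp add: D1_def bh K_deriv_half)
    show "r = 1 / 2 \<longrightarrow> b = 0"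
    proof
      assume half: "r = 1 / 2"
      show "b = 0" unfolding b_def half bh by (simp add: K_deriv_half)
    qed
    show "\<forall>p\<in>{0..1 / 2}. ?h p \<le> D r + b * p + c * ?g p"
    proof
      fix p :: real assume "p \<in> {0..1 / 2}"
      then show "?h p \<le> D r + b * p + c * ?g p" using D_le[of p] by (simp add: D_def)
    qed
    show "?h 0 = D r + c * ?g 0" using D0 by (simp add: D_def)
    show "?h r = D r + b * r + c * ?g r" by (simp add: D_def)
  qed
qed

text \<open>Three extensions: complementing the channel reaches \<delta> > 1/2, reflecting the input
  reaches p > 1/2, and a horizontal plane serves r = 0.\<close>

lemma supporting_line:
  assumes "0 \<le> \<delta>" "\<delta> \<le> 1" "2 \<le> \<beta>" "0 \<le> r" "r \<le> 1 / 2"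
  obtains c b a where "0 \<le> c" "r = 1 / 2 \<longrightarrow> b = 0"
    and "\<forall>p\<in>{0..1}. K_bern \<beta> (bconv p \<delta>) \<le> a + b * p + c * K_bern \<beta> p"
    and "K_bern \<beta> \<delta> = a + c"
    and "K_bern \<beta> (bconv r \<delta>) = a + b * r + c * K_bern \<beta> r"
proof -
  \<comment> \<open>The case of positive r', in continuation form because r = 0 also uses it, with
    r' = 1/2.\<close>
  have pos: thesis if r: "0 < r'" "r' \<le> 1 / 2"
    and imp: "\<And>a b c. 0 \<le> c \<Longrightarrow> (r' = 1 / 2 \<longrightarrow> b = 0)
      \<Longrightarrow> (\<forall>p\<in>{0..1}. K_bern \<beta> (bconv p \<delta>) \<le> a + b * p + c * K_bern \<beta> p)
      \<Longrightarrow> K_bern \<beta> \<delta> = a + c \<Longrightarrow> K_bern \<beta> (bconv r' \<delta>) = a + b * r' + c * K_bern \<beta> r' \<Longrightarrow> thesis" for r'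
  proof -
    define \<epsilon> where "\<epsilon> = min \<delta> (1 - \<delta>)"
    have \<epsilon>: "0 \<le> \<epsilon>" "\<epsilon> \<le> 1 / 2" using assms by (auto simp: \<epsilon>_def min_def)
    have h: "K_bern \<beta> (bconv p \<epsilon>) = K_bern \<beta> (bconv p \<delta>)" if "0 \<le> p" "p \<le> 1" for p
      using that assms K_bern_bconv_complement(2)[of p \<delta> \<beta>] by (auto simp: \<epsilon>_def min_def)
    obtain c b a where *: "0 \<le> c" "0 \<le> b" "r' = 1 / 2 \<longrightarrow> b = 0"
      "\<forall>p\<in>{0..1 / 2}. K_bern \<beta> (bconv p \<epsilon>) \<le> a + b * p + c * K_bern \<beta> p"
      "K_bern \<beta> (bconv 0 \<epsilon>) = a + c * K_bern \<beta> 0"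
      "K_bern \<beta> (bconv r' \<epsilon>) = a + b * r' + c * K_bern \<beta> r'"
      using supporting_line_half[OF \<epsilon> assms(3) r] by blast
    show thesis
    proof (rule imp[of c b a])
      show "0 \<le> c" "r' = 1 / 2 \<longrightarrow> b = 0" by fact+
      show "K_bern \<beta> \<delta> = a + c" using *(5) h[of 0] assms by (simp add: K_bern_0 bconv_def)
      show "K_bern \<beta> (bconv r' \<delta>) = a + b * r' + c * K_bern \<beta> r'" using *(6) h[of r'] r by simp
      have "K_bern \<beta> (bconv p \<delta>) \<le> a + b * p + c * K_bern \<beta> p" if p: "0 \<le> p" "p \<le> 1" for p
      proof (cases "p \<le> 1 / 2")
        case True
        then show ?thesis using bspec[OF *(4), of p] h[of p] p by simp
      next
        case False
        \<comment> \<open>Reflection preserves g and h, and the linear term only grows in passing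
          from 1 - p to p, as b \<ge> 0.\<close>
        have "K_bern \<beta> (bconv p \<delta>) = K_bern \<beta> (bconv (1 - p) \<epsilon>)"
          using K_bern_bconv_complement(1)[of p \<delta> \<beta>] h[of "1 - p"] p assms by simp
        also have "\<dots> \<le> a + b * (1 - p) + c * K_bern \<beta> (1 - p)" using bspec[OF *(4), of "1 - p"] p False by simp
        also have "\<dots> = a + b * (1 - p) + c * K_bern \<beta> p" using p by (simp add: K_bern_symmetric)
        also have "\<dots> \<le> a + b * p + c * K_bern \<beta> p" using *(2) False by (simp add: mult_left_mono)
        finally show ?thesis .
      qed
      then show "\<forall>p\<in>{0..1}. K_bern \<beta> (bconv p \<delta>) \<le> a + b * p + c * K_bern \<beta> p" by simp
    qed
  qed
  show thesis
  proof (cases "r = 0")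
    case True
    \<comment> \<open>The constant plane at height h 0 works: for r' = 1/2 one has b = 0 and c \<ge>
      0, so g \<le> 1 yields h p \<le> a + c = h 0.\<close>
    show thesis
    proof (rule pos[of "1 / 2"])
      fix a b c :: real
      assume *: "0 \<le> c" "(1 / 2 :: real) = 1 / 2 \<longrightarrow> b = 0"
        "\<forall>p\<in>{0..1}. K_bern \<beta> (bconv p \<delta>) \<le> a + b * p + c * K_bern \<beta> p"
        "K_bern \<beta> \<delta> = a + c"
      show thesis
      proof (rule that[of 0 0 "K_bern \<beta> \<delta>"])
        have "K_bern \<beta> (bconv p \<delta>) \<le> K_bern \<beta> \<delta>" if p: "0 \<le> p" "p \<le> 1" for p
      proof -
          have "K_bern \<beta> (bconv p \<delta>) \<le> a + c * K_bern \<beta> p" using *(2,3) p by simp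
        also have "\<dots> \<le> a + c * 1"
          using *(1) p assms K_bern_bounds(2)[of p \<beta>] by (intro add_left_mono mult_left_mono) auto
        finally show ?thesis using *(4) by simp
      qed
      then show "\<forall>p\<in>{0..1}. K_bern \<beta> (bconv p \<delta>) \<le> K_bern \<beta> \<delta> + 0 * p + 0 * K_bern \<beta> p" by simp
      qed (use True in \<open>simp_all add: bconv_def\<close>)
    qed auto
  next
    case False
    then show thesis using assms pos[of r] that by simp
  qed
qed

section \<open>Test channels\<close>

lemma pmf_cond_dist:
  assumes "w \<in> set_pmf (map_pmf W M)"
  shows "pmf (cond_dist M X W w) i = pmf (map_pmf (\<lambda>\<omega>. (W \<omega>, X \<omega>)) M) (w, i) / pmf (map_pmf W M) w"
proof -
  have ne: "set_pmf M \<inter> W -` {w} \<noteq> {}" using assms by auto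
  have "pmf (cond_dist M X W w) i = measure (uniform_measure M (W -` {w})) (X -` {i})"
    by (simp add: cond_dist_def pmf_map cond_pmf.rep_eq[OF ne])
  also have "\<dots> = measure M ((W -` {w}) \<inter> (X -` {i})) / measure M (W -` {w})"
    using ne by (intro measure_uniform_measure)
      (auto simp: measure_pmf.emeasure_eq_measure measure_pmf_zero_iff)
  also have "(W -` {w}) \<inter> (X -` {i}) = (\<lambda>\<omega>. (W \<omega>, X \<omega>)) -` {(w, i)}" by auto
  finally show ?thesis by (simp add: pmf_map)
qed

text \<open>The law of total probability; with X the input it yields E P = q.\<close>

lemma bind_cond_dist: "bind_pmf (map_pmf W M) (cond_dist M X W) = map_pmf X M"
proof -
  have vimage: "{\<omega>. W \<omega> = w} = W -` {w}" for w by auto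
  have "bind_pmf (map_pmf W M) (\<lambda>w. cond_pmf M {\<omega>. W \<omega> = w}) = M"
    by (rule bind_cond_pmf_cancel) (auto simp: pmf_map vimage_def)
  then have "map_pmf X (bind_pmf (map_pmf W M) (\<lambda>w. cond_pmf M {\<omega>. W \<omega> = w})) = map_pmf X M"
    by simp
  then show ?thesis
    by (simp only: map_bind_pmf cond_dist_def[abs_def] vimage)
qed

lemma pmf_bind_Pair: "pmf (bind_pmf A (\<lambda>a. map_pmf (Pair a) (f a))) (a, b) = pmf A a * pmf (f a) b"
proof -
  have "pmf (map_pmf (Pair a') (f a')) (a, b) = indicator {a} a' * pmf (f a) b" for a'
  proof (cases "a' = a")
    case True
    then show ?thesis by (simp add: pmf_map_inj' inj_on_def)
  next
    case False
    then have "(a, b) \<notin> Pair a' ` set_pmf (f a')" by auto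
    then show ?thesis using False by (simp add: pmf_map_outside)
  qed
  then show ?thesis by (simp add: pmf_bind measure_pmf_single)
qed

lemma pmf_False_eq: "pmf p False = 1 - pmf p True"
proof -
  have "(\<Sum>x\<in>UNIV. pmf p x) = 1" by (rule sum_pmf_eq_1) auto
  then show ?thesis by (simp add: UNIV_bool)
qed

lemma bool_pmf_eqI: "pmf p True = pmf r True \<Longrightarrow> p = r"
  by (rule pmf_eqI) (metis (full_types) pmf_False_eq)

lemma lp_norm_bool: "lp_norm \<beta> p = K_bern \<beta> (pmf p True)"
  unfolding K_bern_def by (rule arg_cong[where f = "lp_norm \<beta>"], rule bool_pmf_eqI) (simp add: pmf_le_1)

lemma pmf_bsc_True:
  assumes "0 \<le> \<delta>" "\<delta> \<le> 1"
  shows "pmf (bsc \<delta> x) True = (if x then 1 - \<delta> else \<delta>)"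
proof (cases x)
  case True
  have "pmf (map_pmf Not (bernoulli_pmf \<delta>)) (Not False) = pmf (bernoulli_pmf \<delta>) False"
    by (rule pmf_map_inj') (simp add: inj_on_def)
  moreover have "(\<lambda>flip. x \<noteq> flip) = Not" using True by auto
  ultimately show ?thesis using True assms by (simp add: bsc_def)
qed (use assms in \<open>simp add: bsc_def\<close>)

lemma bsc_joint_eq: "bsc_joint q \<delta> = bind_pmf (bernoulli_pmf q) (\<lambda>x. map_pmf (Pair x) (bsc \<delta> x))"
  by (simp add: bsc_joint_def map_pmf_def)

lemma map_fst_bsc_joint: "map_pmf fst (bsc_joint q \<delta>) = bernoulli_pmf q"
  by (simp add: bsc_joint_eq map_bind_pmf pmf.map_comp o_def bind_return_pmf')

text \<open>Multiplying the conditional independence by P(X = x) turns it into a product formula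
  free of conditional laws, which is convenient both to use and to verify.\<close>

lemma test_laws_iff:
  "M \<in> test_laws \<delta> q \<longleftrightarrow> map_pmf snd M = bsc_joint q \<delta> \<and>
     (\<forall>w x y. pmf M (w, x, y) = pmf (map_pmf (\<lambda>\<omega>. (rv_W \<omega>, rv_X \<omega>)) M) (w, x) * pmf (bsc \<delta> x) y)"
proof (cases "map_pmf snd M = bsc_joint q \<delta>")
  case snd: True
  have "map_pmf rv_X M = map_pmf fst (map_pmf snd M)" by (simp add: pmf.map_comp o_def)
  then have X: "map_pmf rv_X M = bernoulli_pmf q" by (simp add: snd map_fst_bsc_joint)
  let ?PX = "pmf (bernoulli_pmf q)" and ?PWX = "pmf (map_pmf (\<lambda>\<omega>. (rv_W \<omega>, rv_X \<omega>)) M)"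
  have XY: "pmf (map_pmf (\<lambda>\<omega>. (rv_X \<omega>, rv_Y \<omega>)) M) (x, y) = ?PX x * pmf (bsc \<delta> x) y" for x y
    using snd by (simp add: bsc_joint_eq pmf_bind_Pair)
  have XWY: "pmf (map_pmf (\<lambda>\<omega>. (rv_X \<omega>, rv_W \<omega>, rv_Y \<omega>)) M) (x, w, y) = pmf M (w, x, y)" for x w y
    using pmf_map_inj'[of "\<lambda>\<omega>. (rv_X \<omega>, rv_W \<omega>, rv_Y \<omega>)" M "(w, x, y)"] by (auto simp: inj_on_def)
  have "map_pmf (\<lambda>\<omega>. (rv_X \<omega>, rv_W \<omega>)) M = map_pmf prod.swap (map_pmf (\<lambda>\<omega>. (rv_W \<omega>, rv_X \<omega>)) M)"
    by (simp add: pmf.map_comp o_def)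
  then have XW: "pmf (map_pmf (\<lambda>\<omega>. (rv_X \<omega>, rv_W \<omega>)) M) (x, w) = ?PWX (w, x)" for x w
    using pmf_map_inj'[of prod.swap _ "(w, x)"] by simp
  \<comment> \<open>The Markov condition constrains only inputs of positive probability; at the
    others both sides vanish, so the formula extends to all x.\<close>
  have zero: "pmf M (w, x, y) = 0" "?PWX (w, x) = 0" if "x \<notin> set_pmf (bernoulli_pmf q)" for w x y
    using that unfolding X[symmetric] by (auto simp: pmf_eq_0_set_pmf image_iff)
  have "markov_chain M rv_W rv_X rv_Y \<longleftrightarrow>
      (\<forall>x\<in>set_pmf (bernoulli_pmf q). \<forall>w y. pmf M (w, x, y) = ?PWX (w, x) * pmf (bsc \<delta> x) y)"
    unfolding markov_chain_def X
  proof (intro ball_cong refl)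
    fix x assume x: "x \<in> set_pmf (bernoulli_pmf q)"
    then have nz: "?PX x \<noteq> 0" by (simp add: set_pmf_iff)
    have x': "x \<in> set_pmf (map_pmf rv_X M)" using x X by simp
    have "(cond_dist M (\<lambda>\<omega>. (rv_W \<omega>, rv_Y \<omega>)) rv_X x = pair_pmf (cond_dist M rv_W rv_X x) (cond_dist M rv_Y rv_X x))
      \<longleftrightarrow> (\<forall>w y. pmf (cond_dist M (\<lambda>\<omega>. (rv_W \<omega>, rv_Y \<omega>)) rv_X x) (w, y)
                = pmf (cond_dist M rv_W rv_X x) w * pmf (cond_dist M rv_Y rv_X x) y)"
      by (auto simp: pmf_eq_iff pmf_pair)
    also have "\<dots> \<longleftrightarrow> (\<forall>w y. pmf M (w, x, y) = ?PWX (w, x) * pmf (bsc \<delta> x) y)"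
      unfolding pmf_cond_dist[OF x'] XWY XW XY X using nz by (simp add: field_simps)
    finally show "(cond_dist M (\<lambda>\<omega>. (rv_W \<omega>, rv_Y \<omega>)) rv_X x = pair_pmf (cond_dist M rv_W rv_X x) (cond_dist M rv_Y rv_X x))
      \<longleftrightarrow> (\<forall>w y. pmf M (w, x, y) = ?PWX (w, x) * pmf (bsc \<delta> x) y)" .
  qed
  also have "\<dots> \<longleftrightarrow> (\<forall>w x y. pmf M (w, x, y) = ?PWX (w, x) * pmf (bsc \<delta> x) y)"
  proof (intro iffI allI ballI)
    fix w x y
    assume *: "\<forall>x\<in>set_pmf (bernoulli_pmf q). \<forall>w y. pmf M (w, x, y) = ?PWX (w, x) * pmf (bsc \<delta> x) y"
    show "pmf M (w, x, y) = ?PWX (w, x) * pmf (bsc \<delta> x) y"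
      using * zero(1)[of x w y] zero(2)[of x w] by (cases "x \<in> set_pmf (bernoulli_pmf q)") auto
  qed auto
  finally show ?thesis using snd by (simp add: test_laws_def)
qed (simp add: test_laws_def)

text \<open>The random variable P of the overview, as a function of the value of W. At values of
  probability 0 it is unspecified but still a probability, so its bounds hold everywhere.\<close>

definition input_prob :: "(nat \<times> bool \<times> bool) pmf \<Rightarrow> nat \<Rightarrow> real" where
  "input_prob M w = pmf (cond_dist M rv_X rv_W w) True"

lemma input_prob_bounds: "0 \<le> input_prob M w" "input_prob M w \<le> 1"
  by (simp_all add: input_prob_def pmf_le_1)

text \<open>Summing the product formula over the input and dividing by P(W = w) passes the
  conditional input law through the channel.\<close>

lemma pmf_output_cond_dist:
  assumes M: "M \<in> test_laws \<delta> q" and w: "w \<in> set_pmf (map_pmf rv_W M)" and \<delta>: "0 \<le> \<delta>" "\<delta> \<le> 1"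
  shows "pmf (cond_dist M rv_Y rv_W w) True = bconv (input_prob M w) \<delta>"
proof -
  let ?PWX = "pmf (map_pmf (\<lambda>\<omega>. (rv_W \<omega>, rv_X \<omega>)) M)"
  have "(\<lambda>\<omega>. (rv_W \<omega>, rv_Y \<omega>)) -` {(w, True)} = {(w, True, True), (w, False, True)}" by auto
  then have "pmf (map_pmf (\<lambda>\<omega>. (rv_W \<omega>, rv_Y \<omega>)) M) (w, True) = pmf M (w, True, True) + pmf M (w, False, True)"
    by (simp add: pmf_map measure_measure_pmf_finite)
  also have "\<dots> = ?PWX (w, True) * (1 - \<delta>) + ?PWX (w, False) * \<delta>"
    using M by (simp only: test_laws_iff pmf_bsc_True[OF \<delta>] if_True if_False)
  finally have "pmf (cond_dist M rv_Y rv_W w) True =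
      pmf (cond_dist M rv_X rv_W w) True * (1 - \<delta>) + pmf (cond_dist M rv_X rv_W w) False * \<delta>"
    by (simp add: pmf_cond_dist[OF w] add_divide_distrib)
  then show ?thesis by (simp add: pmf_False_eq input_prob_def bconv_def algebra_simps)
qed

lemma arimoto_K_input:
  "arimoto_K \<beta> M rv_X rv_W = measure_pmf.expectation (map_pmf rv_W M) (\<lambda>w. K_bern \<beta> (input_prob M w))"
  unfolding arimoto_K_def lp_norm_bool input_prob_def ..

lemma arimoto_K_output:
  assumes "M \<in> test_laws \<delta> q" "0 \<le> \<delta>" "\<delta> \<le> 1"
  shows "arimoto_K \<beta> M rv_Y rv_W =
    measure_pmf.expectation (map_pmf rv_W M) (\<lambda>w. K_bern \<beta> (bconv (input_prob M w) \<delta>))"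
  unfolding arimoto_K_def lp_norm_bool
  by (rule integral_cong_AE) (use assms in \<open>auto simp: AE_measure_pmf_iff pmf_output_cond_dist\<close>)

lemma expectation_input_prob:
  assumes "M \<in> test_laws \<delta> q" "0 \<le> q" "q \<le> 1"
  shows "measure_pmf.expectation (map_pmf rv_W M) (input_prob M) = q"
proof -
  have "map_pmf rv_X M = map_pmf fst (map_pmf snd M)" by (simp add: pmf.map_comp o_def)
  then have "map_pmf rv_X M = bernoulli_pmf q"
    using assms by (simp add: map_fst_bsc_joint test_laws_def)
  then have "bernoulli_pmf q = bind_pmf (map_pmf rv_W M) (cond_dist M rv_X rv_W)"
    by (simp add: bind_cond_dist)
  then have "pmf (bernoulli_pmf q) True = pmf (bind_pmf (map_pmf rv_W M) (cond_dist M rv_X rv_W)) True"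
    by simp
  then show ?thesis using assms by (simp add: pmf_bind input_prob_def)
qed

text \<open>Draw w from N, then x from Bernoulli(P w), then send x through the channel. Hence every
  [0, 1]-valued P with mean q is realisable, and the problem concerns such P only.\<close>

lemma test_law_with_input_probs:
  fixes N :: "nat pmf"
  assumes P: "\<And>w. 0 \<le> P w" "\<And>w. P w \<le> 1" and q: "measure_pmf.expectation N P = q"
  obtains M where "M \<in> test_laws \<delta> q" "map_pmf rv_W M = N" "\<And>w. w \<in> set_pmf N \<Longrightarrow> input_prob M w = P w"
proof -
  define M where "M = bind_pmf N (\<lambda>w. map_pmf (Pair w)
     (bind_pmf (bernoulli_pmf (P w)) (\<lambda>x. map_pmf (Pair x) (bsc \<delta> x))))"
  have q01: "0 \<le> q" "q \<le> 1"
  proof -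
    show "0 \<le> q" unfolding q[symmetric] using P by (intro integral_nonneg_AE) auto
    have "integrable N P" using P by (intro measure_pmf.integrable_const_bound[where B = 1]) auto
    then show "q \<le> 1" unfolding q[symmetric] using P by (intro measure_pmf.integral_le_const) auto
  qed
  \<comment> \<open>A mixture of Bernoulli laws is Bernoulli with the mean parameter; this gives X
    its prescribed law.\<close>
  have mix: "bind_pmf N (\<lambda>w. bernoulli_pmf (P w)) = bernoulli_pmf q"
    by (rule bool_pmf_eqI) (simp add: pmf_bind P q q01)
  have "map_pmf snd M = bind_pmf (bind_pmf N (\<lambda>w. bernoulli_pmf (P w))) (\<lambda>x. map_pmf (Pair x) (bsc \<delta> x))"
    by (simp add: M_def map_bind_pmf pmf.map_comp o_def bind_assoc_pmf)
  then have snd: "map_pmf snd M = bsc_joint q \<delta>" by (simp add: mix bsc_joint_eq)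
  have WX: "map_pmf (\<lambda>\<omega>. (rv_W \<omega>, rv_X \<omega>)) M = bind_pmf N (\<lambda>w. map_pmf (Pair w) (bernoulli_pmf (P w)))"
    by (simp add: M_def map_bind_pmf pmf.map_comp o_def) (simp add: map_pmf_def)
  have W: "map_pmf rv_W M = N"
    by (simp add: M_def map_bind_pmf pmf.map_comp o_def bind_return_pmf')
  have "M \<in> test_laws \<delta> q"
    unfolding test_laws_iff WX using snd by (simp add: M_def pmf_bind_Pair)
  moreover have "input_prob M w = P w" if w: "w \<in> set_pmf N" for w
  proof -
    have "w \<in> set_pmf (map_pmf rv_W M)" using w W by simp
    from pmf_cond_dist[OF this, of rv_X True] show ?thesis
      using w P unfolding WX W pmf_bind_Pair input_prob_def by (simp add: set_pmf_iff)
  qed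
  ultimately show thesis using W that by blast
qed

text \<open>Two independent coins: the first selects the point 0 with probability \<alpha>, the
  second splits the remaining mass between 1 and 2.\<close>

lemma three_point_pmf:
  assumes "0 \<le> \<alpha>" "\<alpha> \<le> 1" "0 \<le> s" "s \<le> 1"
  obtains N :: "nat pmf"
  where "\<And>f :: nat \<Rightarrow> real. measure_pmf.expectation N f = \<alpha> * f 0 + (1 - \<alpha>) * (s * f 1 + (1 - s) * f 2)"
proof
  fix f :: "nat \<Rightarrow> real"
  let ?N = "map_pmf (\<lambda>(t, u). if t then 0 else if u then 1 else 2)
     (pair_pmf (bernoulli_pmf \<alpha>) (bernoulli_pmf s)) :: nat pmf"
  have U: "UNIV = {(True, True), (True, False), (False, True), (False, False)}" by auto
  have "measure_pmf.expectation p g = (\<Sum>a\<in>UNIV. g a * pmf p a)" for p :: "(bool \<times> bool) pmf" and g :: "_ \<Rightarrow> real"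
    by (rule integral_measure_pmf_real) auto
  then show "measure_pmf.expectation ?N f = \<alpha> * f 0 + (1 - \<alpha>) * (s * f 1 + (1 - s) * f 2)"
    using assms by (simp add: U pmf_pair) (simp add: algebra_simps)
qed

text \<open>The pointwise bound is averaged over P, using E P = q; all integrands are bounded, hence
  integrable.\<close>

lemma arimoto_K_output_le:
  assumes M: "M \<in> test_laws \<delta> q" and \<delta>: "0 \<le> \<delta>" "\<delta> \<le> 1" and q: "0 \<le> q" "q \<le> 1" and \<beta>: "1 < \<beta>"
    and line: "\<forall>p\<in>{0..1}. K_bern \<beta> (bconv p \<delta>) \<le> a + b * p + c * K_bern \<beta> p"
  shows "arimoto_K \<beta> M rv_Y rv_W \<le> a + b * q + c * arimoto_K \<beta> M rv_X rv_W"
proof -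
  let ?N = "map_pmf rv_W M" and ?P = "input_prob M"
  have int: "integrable ?N (\<lambda>w. K_bern \<beta> (f w))" if "\<And>w. 0 \<le> f w \<and> f w \<le> 1" for f :: "nat \<Rightarrow> real"
  proof (rule measure_pmf.integrable_const_bound[where B = 1])
    show "AE w in ?N. norm (K_bern \<beta> (f w)) \<le> 1"
    proof (rule AE_I2)
      fix w show "norm (K_bern \<beta> (f w)) \<le> 1"
        using K_bern_bounds[of "f w" \<beta>] that[of w] \<beta> by simp
    qed
  qed simp
  have intP: "integrable ?N ?P"
    by (rule measure_pmf.integrable_const_bound[where B = 1]) (auto simp: input_prob_bounds)
  have bc: "0 \<le> bconv (?P w) \<delta> \<and> bconv (?P w) \<delta> \<le> 1" for w
    using bconv_bounds[OF input_prob_bounds \<delta>] by blast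
  have intK: "integrable ?N (\<lambda>w. K_bern \<beta> (?P w))"
    by (rule int) (simp add: input_prob_bounds)
  have "arimoto_K \<beta> M rv_Y rv_W = measure_pmf.expectation ?N (\<lambda>w. K_bern \<beta> (bconv (?P w) \<delta>))"
    by (rule arimoto_K_output[OF M \<delta>])
  also have "\<dots> \<le> measure_pmf.expectation ?N (\<lambda>w. a + b * ?P w + c * K_bern \<beta> (?P w))"
    by (intro integral_mono Bochner_Integration.integrable_add integrable_mult_right
        measure_pmf.integrable_const intK intP int bc line[rule_format])
      (simp add: input_prob_bounds)
  also have "\<dots> = a + b * q + c * arimoto_K \<beta> M rv_X rv_W"
    unfolding arimoto_K_input expectation_input_prob[OF M q, symmetric]
    using intP intK by (simp del: integral_map_pmf)
  finally show ?thesis .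
qed

text \<open>Averages of norms that are at least 1/2. Positivity is what allows passing between K and
  its logarithm.\<close>

lemma arimoto_K_ge_half:
  assumes "M \<in> test_laws \<delta> q" "0 \<le> \<delta>" "\<delta> \<le> 1" "1 < \<beta>"
  shows "1 / 2 \<le> arimoto_K \<beta> M rv_X rv_W" "1 / 2 \<le> arimoto_K \<beta> M rv_Y rv_W"
proof -
  have *: "1 / 2 \<le> measure_pmf.expectation (map_pmf rv_W M) (\<lambda>w. K_bern \<beta> (f w))"
    if f: "\<And>w. 0 \<le> f w \<and> f w \<le> 1" for f :: "nat \<Rightarrow> real"
  proof (rule measure_pmf.integral_ge_const)
    have b: "1 / 2 \<le> K_bern \<beta> (f w)" "K_bern \<beta> (f w) \<le> 1" for w
      using K_bern_bounds[of "f w" \<beta>] f[of w] assms by auto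
    then show "AE w in map_pmf rv_W M. 1 / 2 \<le> K_bern \<beta> (f w)" by simp
    have "norm (K_bern \<beta> (f w)) \<le> 1" for w using b[of w] by simp
    then show "integrable (map_pmf rv_W M) (\<lambda>w. K_bern \<beta> (f w))"
      by (intro measure_pmf.integrable_const_bound[where B = 1]) auto
  qed
  show "1 / 2 \<le> arimoto_K \<beta> M rv_X rv_W"
    unfolding arimoto_K_input by (rule *) (simp add: input_prob_bounds)
  show "1 / 2 \<le> arimoto_K \<beta> M rv_Y rv_W"
    unfolding arimoto_K_output[OF assms(1-3)]
    by (rule *) (use bconv_bounds[OF input_prob_bounds assms(2,3)] in blast)
qed

section \<open>Time sharing: attainment, optimality and range\<close>

text \<open>P equals r with probability \<alpha>, and the remaining mass is split between 1 and 0 to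
  give mean q. The split affects nothing else, because g and h take equal values at 0 and 1.\<close>

lemma time_sharing_law:
  assumes \<delta>: "0 \<le> \<delta>" "\<delta> \<le> 1" and q: "0 \<le> q" "q \<le> 1 / 2" and \<beta>: "1 < \<beta>"
    and \<alpha>: "0 \<le> \<alpha>" "\<alpha> \<le> 1" and r: "r = q / max \<alpha> (2 * q)"
  obtains M where "M \<in> test_laws \<delta> q"
    "arimoto_K \<beta> M rv_X rv_W = (1 - \<alpha>) + \<alpha> * K_bern \<beta> r"
    "arimoto_K \<beta> M rv_Y rv_W = \<alpha> * K_bern \<beta> (bconv r \<delta>) + (1 - \<alpha>) * K_bern \<beta> \<delta>"
proof -
  \<comment> \<open>For \<alpha> = q = 0 the division by zero gives r = 0, and \<alpha> r = q still
    holds.\<close>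
  have r01: "0 \<le> r" "r \<le> 1" and ar: "\<alpha> * r \<le> q" and rq: "r = 1 / 2 \<or> \<alpha> * r = q" and a1: "\<alpha> = 1 \<Longrightarrow> \<alpha> * r = q"
    using q \<alpha> by (auto simp: r max_def divide_simps)
  have s1: "q - \<alpha> * r \<le> 1 - \<alpha>" using rq
  proof
    assume half: "r = 1 / 2"
    show ?thesis unfolding half using q \<alpha> by linarith
  qed (use \<alpha> in simp)
  \<comment> \<open>Solves \<alpha> r + (1 - \<alpha>) s = q. For \<alpha> = 1 division by zero
    gives s = 0, consistent with \<alpha> r = q.\<close>
  define s where "s = (q - \<alpha> * r) / (1 - \<alpha>)"
  have s: "0 \<le> s" "s \<le> 1" "(1 - \<alpha>) * s = q - \<alpha> * r"
    using \<alpha> ar s1 a1 by (auto simp: s_def divide_simps)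
  obtain N :: "nat pmf" where N: "\<And>f :: nat \<Rightarrow> real. measure_pmf.expectation N f
      = \<alpha> * f 0 + (1 - \<alpha>) * (s * f 1 + (1 - s) * f 2)"
    using three_point_pmf[OF \<alpha> s(1,2)] by blast
  define P :: "nat \<Rightarrow> real" where "P w = (if w = 0 then r else if w = 1 then 1 else 0)" for w
  have "measure_pmf.expectation N P = q"
    using s by (simp add: N P_def)
  moreover have P01: "0 \<le> P w" "P w \<le> 1" for w using r01 by (auto simp: P_def)
  ultimately obtain M where M: "M \<in> test_laws \<delta> q" "map_pmf rv_W M = N"
      "\<And>w. w \<in> set_pmf N \<Longrightarrow> input_prob M w = P w"
    using test_law_with_input_probs[of P N q \<delta>] by blast
  have b1: "K_bern \<beta> (bconv 1 \<delta>) = K_bern \<beta> \<delta>"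
    using K_bern_bconv_complement(1)[of 0 \<delta> \<beta>] \<delta> by (simp add: bconv_def)
  have b0: "bconv 0 \<delta> = \<delta>" by (simp add: bconv_def)
  have "measure_pmf.expectation N (\<lambda>w. f (input_prob M w)) = \<alpha> * f r + (1 - \<alpha>) * (s * f 1 + (1 - s) * f 0)"
    for f :: "real \<Rightarrow> real"
  proof -
    have "measure_pmf.expectation N (\<lambda>w. f (input_prob M w)) = measure_pmf.expectation N (\<lambda>w. f (P w))"
      by (rule integral_cong_AE) (auto simp: AE_measure_pmf_iff M)
    then show ?thesis by (simp add: N P_def)
  qed
  note * = this[of "K_bern \<beta>"] this[of "\<lambda>p. K_bern \<beta> (bconv p \<delta>)"]
  show thesis
  proof (rule that[OF M(1)])
    show "arimoto_K \<beta> M rv_X rv_W = (1 - \<alpha>) + \<alpha> * K_bern \<beta> r"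
      using \<beta> by (simp add: arimoto_K_input M(2) * K_bern_0 K_bern_1)
    show "arimoto_K \<beta> M rv_Y rv_W = \<alpha> * K_bern \<beta> (bconv r \<delta>) + (1 - \<alpha>) * K_bern \<beta> \<delta>"
      by (simp add: arimoto_K_output[OF M(1) \<delta>] M(2) * b0 b1) (simp add: algebra_simps)
  qed
qed

text \<open>The plane for r bounds every test law and is attained by the time-sharing law. As c
  \<ge> 0, an inequality on K(X|W) is enough, which the entropy form requires.\<close>

lemma time_sharing_optimal:
  assumes \<delta>: "0 \<le> \<delta>" "\<delta> \<le> 1" and q: "0 \<le> q" "q \<le> 1 / 2" and \<beta>: "2 \<le> \<beta>"
    and \<alpha>: "0 \<le> \<alpha>" "\<alpha> \<le> 1" and r: "r = q / max \<alpha> (2 * q)"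
    and M: "M \<in> test_laws \<delta> q" and le: "arimoto_K \<beta> M rv_X rv_W \<le> (1 - \<alpha>) + \<alpha> * K_bern \<beta> r"
  shows "arimoto_K \<beta> M rv_Y rv_W \<le> \<alpha> * K_bern \<beta> (bconv r \<delta>) + (1 - \<alpha>) * K_bern \<beta> \<delta>"
proof -
  have r01: "0 \<le> r" "r \<le> 1 / 2"
    using q \<alpha> by (auto simp: r max_def divide_simps)
  have rq: "r = 1 / 2 \<or> \<alpha> * r = q"
    using q \<alpha> by (auto simp: r max_def divide_simps)
  obtain c b a where c: "0 \<le> c" and b: "r = 1 / 2 \<longrightarrow> b = 0"
    and line: "\<forall>p\<in>{0..1}. K_bern \<beta> (bconv p \<delta>) \<le> a + b * p + c * K_bern \<beta> p"
    and eq: "K_bern \<beta> \<delta> = a + c" "K_bern \<beta> (bconv r \<delta>) = a + b * r + c * K_bern \<beta> r"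
    using supporting_line[OF \<delta> \<beta> r01] by blast
  have "arimoto_K \<beta> M rv_Y rv_W \<le> a + b * q + c * arimoto_K \<beta> M rv_X rv_W"
    by (rule arimoto_K_output_le[OF M \<delta>]) (use q \<beta> line in auto)
  also have "\<dots> \<le> a + b * q + c * ((1 - \<alpha>) + \<alpha> * K_bern \<beta> r)"
    using le c by (intro add_left_mono mult_left_mono)
  \<comment> \<open>Either the mean is carried by r alone, or r = 1/2 and the plane has no linear
    term.\<close>
  also have "b * q = b * (\<alpha> * r)" using rq b by auto
  also have "a + b * (\<alpha> * r) + c * ((1 - \<alpha>) + \<alpha> * K_bern \<beta> r)
      = \<alpha> * K_bern \<beta> (bconv r \<delta>) + (1 - \<alpha>) * K_bern \<beta> \<delta>"
    unfolding eq by (simp add: algebra_simps)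
  finally show ?thesis .
qed

text \<open>The lower bound is convexity of g; every value is reached by the intermediate value
  theorem between \<alpha> = 1 and \<alpha> = 0.\<close>

lemma time_sharing_input_range:
  assumes q: "0 \<le> q" "q \<le> 1 / 2" and \<beta>: "1 < \<beta>"
  shows "{(1 - \<alpha>) + \<alpha> * K_bern \<beta> (q / max \<alpha> (2 * q)) |\<alpha>. 0 \<le> \<alpha> \<and> \<alpha> \<le> 1} = {K_bern \<beta> q..1}"
    (is "?L = ?R")
proof (intro equalityI subsetI)
  fix x assume "x \<in> ?L"
  then obtain \<alpha> where \<alpha>: "0 \<le> \<alpha>" "\<alpha> \<le> 1" and x: "x = (1 - \<alpha>) + \<alpha> * K_bern \<beta> (q / max \<alpha> (2 * q))"
    by blast
  let ?r = "q / max \<alpha> (2 * q)"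
  have r01: "0 \<le> ?r" "?r \<le> 1 / 2"
    using q \<alpha> by (auto simp: max_def divide_simps)
  have K: "K_bern \<beta> ?r \<le> 1" using K_bern_bounds(2)[of ?r \<beta>] r01 \<beta> by simp
  have "K_bern \<beta> q \<le> x"
  proof (cases "\<alpha> < 2 * q")
    case True
    then have r: "?r = 1 / 2" using q \<alpha> by (auto simp: max_def)
    \<comment> \<open>Here r stays 1/2, so x decreases in \<alpha>; it is compared with its value at
      \<alpha> = 2 q, where the chord bound applies.\<close>
    have "K_bern \<beta> q \<le> (1 - 2 * q) + 2 * q * K_bern \<beta> (1 / 2)"
      using K_bern_chord[of "2 * q" "1 / 2" \<beta>] q \<beta> by simp
    moreover have "0 \<le> (2 * q - \<alpha>) * (1 - K_bern \<beta> (1 / 2))"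
      using True K_bern_bounds(2)[of "1 / 2" \<beta>] \<beta> by simp
    ultimately show ?thesis unfolding x r by (simp add: algebra_simps)
  next
    case False
    then have "\<alpha> * ?r = q" using q \<alpha> by (auto simp: max_def)
    then show ?thesis using K_bern_chord[of \<alpha> ?r \<beta>] \<alpha> r01 \<beta> x by simp
  qed
  moreover have "0 \<le> \<alpha> * (1 - K_bern \<beta> ?r)" using \<alpha> K by simp
  then have "x \<le> 1" unfolding x by (simp add: algebra_simps)
  ultimately show "x \<in> ?R" by simp
next
  fix x assume x: "x \<in> ?R"
  let ?f = "\<lambda>\<alpha>. (1 - \<alpha>) + \<alpha> * K_bern \<beta> (q / max \<alpha> (2 * q))"
  show "x \<in> ?L"
  \<comment> \<open>For q = 0 the range is the single point 1. Otherwise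
    \<open>max \<alpha> (2 * q)\<close> stays positive, which makes the quotient continuous.\<close>
  proof (cases "q = 0")
    case True
    then have "x = ?f 0" using x \<beta> by (simp add: K_bern_0)
    then show ?thesis by force
  next
    case False
    have "continuous_on {0..1} (\<lambda>\<alpha>. K_bern \<beta> (q / max \<alpha> (2 * q)))"
    proof (rule continuous_on_compose2[OF continuous_on_K_bern[of \<beta>]])
      show "continuous_on {0..1} (\<lambda>\<alpha>. q / max \<alpha> (2 * q))"
        using False q by (intro continuous_intros) (auto simp: max_def)
      show "(\<lambda>\<alpha>. q / max \<alpha> (2 * q)) ` {0..1} \<subseteq> {0..1}"
        using False q by (auto simp: max_def divide_simps)
    qed (use \<beta> in simp)
    then have "continuous_on {0..1} ?f" by (intro continuous_intros)
    moreover have "max 1 (2 * q) = 1" using q by simp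
    then have "?f 1 = K_bern \<beta> q" by simp
    ultimately obtain \<alpha> where "0 \<le> \<alpha>" "\<alpha> \<le> 1" "?f \<alpha> = x"
      using IVT2'[of ?f 1 x 0] x by auto
    then show ?thesis by force
  qed
qed

section \<open>The boundary curve and its entropy form\<close>

theorem theorem4:
  fixes \<delta> q \<beta> :: real
  assumes "0 \<le> \<delta>" "\<delta> \<le> 1" "0 \<le> q" "q \<le> 1 / 2" "2 \<le> \<beta>"
  shows "(\<forall>x. K_bern \<beta> q \<le> x \<and> x \<le> 1 \<longrightarrow> is_maximum (K_values \<beta> \<delta> q x) (U_T \<beta> \<delta> q x)) \<and>
    U_curve \<beta> \<delta> q =
      {((1 - \<alpha>) + \<alpha> * K_bern \<beta> (q / z),
        \<alpha> * K_bern \<beta> (bconv (q / z) \<delta>) + (1 - \<alpha>) * K_bern \<beta> \<delta>) |\<alpha> z.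
       0 \<le> \<alpha> \<and> \<alpha> \<le> 1 \<and> z = max \<alpha> (2 * q)} \<and>
    (\<forall>(x, y) \<in> U_curve \<beta> \<delta> q.
       is_minimum {arimoto_H \<beta> M rv_Y rv_W |M.
                     M \<in> test_laws \<delta> q \<and> arimoto_H \<beta> M rv_X rv_W \<ge> \<beta> / (1 - \<beta>) * ln x}
         (\<beta> / (1 - \<beta>) * ln y))"
proof -
  define X Y where "X \<alpha> = (1 - \<alpha>) + \<alpha> * K_bern \<beta> (q / max \<alpha> (2 * q))"
    and "Y \<alpha> = \<alpha> * K_bern \<beta> (bconv (q / max \<alpha> (2 * q)) \<delta>) + (1 - \<alpha>) * K_bern \<beta> \<delta>" for \<alpha>
  have \<beta>: "1 < \<beta>" using assms by simp
  have law: "\<exists>M\<in>test_laws \<delta> q. arimoto_K \<beta> M rv_X rv_W = X \<alpha> \<and> arimoto_K \<beta> M rv_Y rv_W = Y \<alpha>"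
    if "0 \<le> \<alpha>" "\<alpha> \<le> 1" for \<alpha>
    using time_sharing_law[OF assms(1-4) \<beta> that refl] unfolding X_def Y_def by metis
  have opt: "arimoto_K \<beta> M rv_Y rv_W \<le> Y \<alpha>"
    if "0 \<le> \<alpha>" "\<alpha> \<le> 1" "M \<in> test_laws \<delta> q" "arimoto_K \<beta> M rv_X rv_W \<le> X \<alpha>" for \<alpha> M
    using time_sharing_optimal[OF assms that(1,2) refl that(3)] that(4) unfolding X_def Y_def by blast
  have range: "{X \<alpha> |\<alpha>. 0 \<le> \<alpha> \<and> \<alpha> \<le> 1} = {K_bern \<beta> q..1}"
    using time_sharing_input_range[OF assms(3,4) \<beta>] by (simp add: X_def)
  have max: "is_maximum (K_values \<beta> \<delta> q (X \<alpha>)) (Y \<alpha>)" if \<alpha>: "0 \<le> \<alpha>" "\<alpha> \<le> 1" for \<alpha>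
    unfolding is_maximum_def K_values_def using law[OF \<alpha>] opt[OF \<alpha>] by force
  \<comment> \<open>By antisymmetry a maximum is unique, so the definite description denotes
    it.\<close>
  have U: "U_T \<beta> \<delta> q (X \<alpha>) = Y \<alpha>" if \<alpha>: "0 \<le> \<alpha>" "\<alpha> \<le> 1" for \<alpha>
    unfolding U_T_def
  proof (rule the_equality)
    show "m = Y \<alpha>" if "is_maximum (K_values \<beta> \<delta> q (X \<alpha>)) m" for m
      using that max[OF \<alpha>] unfolding is_maximum_def by (meson order_antisym)
  qed (rule max[OF \<alpha>])
  have 1: "is_maximum (K_values \<beta> \<delta> q x) (U_T \<beta> \<delta> q x)" if "K_bern \<beta> q \<le> x" "x \<le> 1" for x
  proof -
    have "x \<in> {X \<alpha> |\<alpha>. 0 \<le> \<alpha> \<and> \<alpha> \<le> 1}" unfolding range using that by simp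
    then show ?thesis using max U by auto
  qed
  have "U_curve \<beta> \<delta> q = {(x, U_T \<beta> \<delta> q x) |x. x \<in> {X \<alpha> |\<alpha>. 0 \<le> \<alpha> \<and> \<alpha> \<le> 1}}"
    unfolding range U_curve_def by simp
  also have "\<dots> = {(X \<alpha>, Y \<alpha>) |\<alpha>. 0 \<le> \<alpha> \<and> \<alpha> \<le> 1}"
    using U by fastforce
  finally have 2: "U_curve \<beta> \<delta> q = {(X \<alpha>, Y \<alpha>) |\<alpha>. 0 \<le> \<alpha> \<and> \<alpha> \<le> 1}" .
  \<comment> \<open>This sign reverses both orders: large K(Y|W) means small H(Y|W), and the
    constraint K(X|W) \<le> x becomes a lower bound on H(X|W).\<close>
  have neg: "\<beta> / (1 - \<beta>) < 0" using \<beta> by (simp add: divide_less_0_iff)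
  have 3: "is_minimum {arimoto_H \<beta> M rv_Y rv_W |M.
                     M \<in> test_laws \<delta> q \<and> arimoto_H \<beta> M rv_X rv_W \<ge> \<beta> / (1 - \<beta>) * ln (X \<alpha>)}
         (\<beta> / (1 - \<beta>) * ln (Y \<alpha>))" if \<alpha>: "0 \<le> \<alpha>" "\<alpha> \<le> 1" for \<alpha>
  proof -
    obtain M0 where M0: "M0 \<in> test_laws \<delta> q" "arimoto_K \<beta> M0 rv_X rv_W = X \<alpha>" "arimoto_K \<beta> M0 rv_Y rv_W = Y \<alpha>"
      using law[OF \<alpha>] by blast
    note pos = arimoto_K_ge_half[OF _ assms(1,2) \<beta>]
    have XY: "0 < X \<alpha>" "0 < Y \<alpha>" using pos[OF M0(1)] M0 by simp_all
    have "\<beta> / (1 - \<beta>) * ln (Y \<alpha>) \<le> arimoto_H \<beta> M rv_Y rv_W"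
      if M: "M \<in> test_laws \<delta> q" and H: "\<beta> / (1 - \<beta>) * ln (X \<alpha>) \<le> arimoto_H \<beta> M rv_X rv_W" for M
    proof -
      have K: "0 < arimoto_K \<beta> M rv_X rv_W" "0 < arimoto_K \<beta> M rv_Y rv_W" using pos[OF M] by simp_all
      have "ln (arimoto_K \<beta> M rv_X rv_W) \<le> ln (X \<alpha>)"
        using H neg unfolding arimoto_H_def by (simp only: mult_le_cancel_left)
      then have "arimoto_K \<beta> M rv_Y rv_W \<le> Y \<alpha>" using opt[OF \<alpha> M] K XY by simp
      then have "ln (arimoto_K \<beta> M rv_Y rv_W) \<le> ln (Y \<alpha>)" using K XY by simp
      then show ?thesis unfolding arimoto_H_def using neg by (intro mult_left_mono_neg) auto
    qed
    then show ?thesis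
      unfolding is_minimum_def using M0 by (auto simp: arimoto_H_def intro!: exI[of _ M0])
  qed
  show ?thesis
    using 1 3 unfolding 2 by (auto simp: X_def Y_def)
qed

end
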